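(* Let $G$ be a finite abelian group and let $a\in\operatorname{Aut}(G)$. Define the formal power series $\mathcal F_{G,a}(q,t)=\sum_{m\ge0}\sum_{S\in\mathsf M_a(G,m)}q^{|\operatorname{supp}(S)|}t^m$. Then $$\mathcal F_{G,a}(q,t)=\frac1{|G|}\sum_{\chi\in\widehat G}\ \prod_{O\in\mathcal O(a)}\frac{1+(q^{\ell(O)}-1)\,\chi(\sigma(O))\,t^{\ell(O)}}{1-\chi(\sigma(O))\,t^{\ell(O)}}.$$ In particular, the ordinary generating function $\mathcal E_{G,a}(t)=\mathcal F_{G,a}(1,t)=\sum_{m\ge0}|\mathsf M_a(G,m)|t^m$ is $$\mathcal E_{G,a}(t)=\frac1{|G|}\sum_{\chi\in\widehat G}\ \prod_{O\in\mathcal O(a)}\frac1{1-\chi(\sigma(O))\,t^{\ell(O)}}.$$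
   Context: $G$ is written additively; $\widehat G$ is the group of characters $G\to\mathbb C^\times$. A sequence over $G$ is a finite unordered sequence of elements of $G$ with repetitions allowed (a multiplicity vector $(b_g)\in\mathbb Z_{\ge0}^G$); its length is $\sum_g b_g$, its sum is $\sum_g b_g g$, its support is $\operatorname{supp}(S)=\{g:b_g>0\}$; it is zero-sum if its sum is $0$. $\mathsf M(G,m)$ is the set of zero-sum sequences of length $m$ (for $m=0$, only the empty sequence). An automorphism $a$ acts on sequences termwise, and $\mathsf M_a(G,m)=\{S\in\mathsf M(G,m):a\cdot S=S\}$. $\mathcal O(a)$ is the set of orbits of (the cyclic group generated by) $a$ on $G$; for $O\in\mathcal O(a)$, $\ell(O)=|O|$ and $\sigma(O)=\sum_{g\in O}g\in G$. *)

theory Defs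
  imports
    Complex_Main
    "HOL-Library.Multiset"
    "HOL-Combinatorics.Orbits"
    "HOL-Computational_Algebra.Polynomial"
    "HOL-Computational_Algebra.Formal_Power_Series"
begin

definition group_automorphism :: "('a::ab_group_add \<Rightarrow> 'a) \<Rightarrow> bool" where
  "group_automorphism a \<longleftrightarrow> bij a \<and> (\<forall>x y. a (x + y) = a x + a y)"

definition characters :: "('a::ab_group_add \<Rightarrow> complex) set" where
  "characters = {\<chi>. (\<forall>x. \<chi> x \<noteq> 0) \<and> (\<forall>x y. \<chi> (x + y) = \<chi> x * \<chi> y)}"

text \<open>Sequences over the group (unordered, with repetitions) are multisets; their length, sum and
  support are \<^const>\<open>size\<close>, \<^const>\<open>sum_mset\<close> and \<^const>\<open>set_mset\<close>.\<close>

definition zero_sum_seqs :: "nat \<Rightarrow> 'a::ab_group_add multiset set" where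
  "zero_sum_seqs m = {S. size S = m \<and> sum_mset S = 0}"

definition fixed_zero_sum_seqs :: "('a::ab_group_add \<Rightarrow> 'a) \<Rightarrow> nat \<Rightarrow> 'a multiset set" where
  "fixed_zero_sum_seqs a m = {S \<in> zero_sum_seqs m. image_mset a S = S}"

text \<open>\<^const>\<open>orbit\<close> uses only the positive powers of the map. For a bijection of a finite type
  this gives the orbits of the cyclic group that it generates, see \<open>orbit_cyclic_group\<close>.\<close>

definition orbits :: "('a \<Rightarrow> 'a) \<Rightarrow> 'a set set" where
  "orbits a = range (orbit a)"

lemma orbit_cyclic_group:
  fixes a :: "'a::finite \<Rightarrow> 'a"
  assumes "bij a"
  shows "orbit a g = {(a ^^ n) g | n. True} \<union> {(inv a ^^ n) g | n. True}"
proof -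
  have perm: "permutation a"
    using assms by (simp add: permutation)
  then have pos: "orbit a g = {(a ^^ n) g | n. True}"
    by (rule orbit_altdef_permutation)
  from perm have "orbit (inv a) g = {(inv a ^^ n) g | n. True}"
    by (intro orbit_altdef_permutation permutation_inverse)
  then have "{(inv a ^^ n) g | n. True} = orbit a g"
    using orbit_inv_eq[OF perm] by simp
  with pos show ?thesis by simp
qed

text \<open>The two-variable series lives in \<open>\<complex>[q][[t]]\<close>: the indeterminate \<open>q\<close> is that of the coefficient
  polynomials and \<open>t\<close> is \<^const>\<open>fps_X\<close>.\<close>

definition support_series :: "('a::ab_group_add \<Rightarrow> 'a) \<Rightarrow> complex poly fps" where
  "support_series a =
     Abs_fps (\<lambda>m. \<Sum>S\<in>fixed_zero_sum_seqs a m. monom 1 (card (set_mset S)))"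

definition counting_series :: "('a::ab_group_add \<Rightarrow> 'a) \<Rightarrow> complex fps" where
  "counting_series a = Abs_fps (\<lambda>m. of_nat (card (fixed_zero_sum_seqs a m)))"

definition eval_q :: "'b::comm_semiring_0 \<Rightarrow> 'b poly fps \<Rightarrow> 'b fps" where
  "eval_q c F = Abs_fps (\<lambda>m. poly (fps_nth F m) c)"

text \<open>Quotient of power series over a commutative ring whose denominator has constant term \<open>1\<close>
  (polynomials have no \<^const>\<open>inverse\<close>, so the operator \<open>/\<close> is unavailable over \<open>\<complex>[q]\<close>). The second
  argument of \<open>fps_right_inverse\<close> is the inverse of that constant term.\<close>

definition fps_quot1 :: "'b::comm_ring_1 fps \<Rightarrow> 'b fps \<Rightarrow> 'b fps" where
  "fps_quot1 f g = f * fps_right_inverse g 1"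

lemma fps_quot1_mult:
  assumes "fps_nth g 0 = 1"
  shows "fps_quot1 f g * g = f"
proof -
  have "g * fps_right_inverse g 1 = 1"
    by (rule fps_right_inverse) (simp add: assms)
  then have "f * (g * fps_right_inverse g 1) = f" by simp
  then show ?thesis by (simp only: fps_quot1_def mult_ac)
qed

end

(* By orthogonality of characters, the zero-sum condition is detected by averaging chi(sum S) over
   all chi. An invariant sequence is a sum of multiples of orbits, so for fixed chi the generating
   function of q^|supp S| chi(sum S) t^|S| factors over the orbits. The factor of an orbit B comes
   from removing one copy of B from a sequence that meets B: the support loses B exactly when B
   occurred once. Clearing denominators turns this into a two-term recurrence.

   Characters separate points because the translations of the finite group are simultaneously
   diagonalizable on functions: a function with f x \<noteq> f 0 has a spectral component for each
   translation that keeps this property, and a joint eigenvector is a multiple of a character. *)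

theory Submission
  imports Defs
begin

section \<open>Characters of a finite abelian group\<close>

lemma sum_const_lessThan_card:
  fixes g :: "'a::comm_monoid_add"
  assumes "finite A"
  shows "(\<Sum>i<card A. g) = (\<Sum>i\<in>A. g)"
  using assms by (induction A rule: finite_induct) (simp_all add: add.commute)

text \<open>Translation by \<open>g\<close> permutes the group, so it preserves the sum of all
  elements; the total shift, one copy of \<open>g\<close> per element, must vanish.\<close>

lemma sum_const_card_UNIV_eq_0:
  fixes g :: "'a::{ab_group_add, finite}"
  shows "(\<Sum>i<card (UNIV :: 'a set). g) = 0"
proof -
  have "(\<Sum>x\<in>(UNIV :: 'a set). x) = (\<Sum>x\<in>UNIV. x + g)"
    by (rule sum.reindex_bij_witness[of _ "\<lambda>x. x + g" "\<lambda>x. x - g"]) auto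
  also have "\<dots> = (\<Sum>x\<in>UNIV. x) + (\<Sum>x\<in>(UNIV :: 'a set). g)"
    by (rule sum.distrib)
  finally show ?thesis
    by (simp add: sum_const_lessThan_card)
qed

text \<open>One step of the simultaneous diagonalization. Spectral components for one translation
  are combinations of translates, and translations commute, so the eigenvalue relations obtained
  earlier survive; this is the third conclusion.\<close>

lemma translation_eigenvector:
  fixes f :: "'a::{ab_group_add, finite} \<Rightarrow> complex"
  assumes neq: "f x \<noteq> f 0"
  obtains h c where "h x \<noteq> h 0" "\<And>y. h (y + g) = c * h y"
    "\<And>z d. (\<forall>y. f (y + z) = d * f y) \<Longrightarrow> (\<forall>y. h (y + z) = d * h y)"
proof -
  define N where "N = card (UNIV :: 'a set)"
  define \<zeta> where "\<zeta> = cis (2 * pi / real N)"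
  define m where "m k = (\<Sum>i<k. g)" for k :: nat
  \<comment> \<open>\<open>h j\<close> is the component of \<open>f\<close> (times \<open>N\<close>) in the eigenspace of the translation by \<open>g\<close> for
    \<open>\<zeta>\<close> to the power \<open>-j\<close>; the components add up to \<open>N f\<close>, so one of them separates \<open>x\<close> from \<open>0\<close>.\<close>
  define h where "h j y = (\<Sum>k<N. (\<zeta> ^ k) ^ j * f (y + m k))" for j y
  have N: "N > 0" by (simp add: N_def finite_UNIV_card_ge_0)
  have \<zeta>_pow: "\<zeta> ^ k = cis (2 * pi * real k / real N)" for k
    by (simp add: \<zeta>_def DeMoivre mult_ac)
  have \<zeta>_N: "\<zeta> ^ N = 1" using N by (simp add: \<zeta>_pow)
  have \<zeta>_neq_1: "\<zeta> ^ k \<noteq> 1" if "0 < k" "k < N" for k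
  proof
    assume "\<zeta> ^ k = 1"
    moreover have "inj_on (\<lambda>k. \<zeta> ^ k) {..<N}"
      using bij_betw_roots_unity[OF N] by (simp add: bij_betw_def \<zeta>_pow)
    ultimately show False using that N by (auto dest!: inj_onD[of _ _ k 0])
  qed
  have orth: "(\<Sum>j<N. (\<zeta> ^ k) ^ j) = (if k = 0 then of_nat N else 0)" if "k < N" for k
  proof (cases "k = 0")
    case False
    have "(\<Sum>j<N. (\<zeta> ^ k) ^ j) = ((\<zeta> ^ k) ^ N - 1) / (\<zeta> ^ k - 1)"
      using False that \<zeta>_neq_1 by (intro geometric_sum) auto
    also have "(\<zeta> ^ k) ^ N = 1"
      by (metis \<zeta>_N power_mult mult.commute power_one)
    finally show ?thesis using False by simp
  qed simp
  \<comment> \<open>Summing over \<open>j\<close> first leaves only \<open>k = 0\<close>, where the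
    shift \<open>m 0\<close> is zero.\<close>
  have sum_h: "(\<Sum>j<N. h j y) = of_nat N * f y" for y
  proof -
    have "(\<Sum>j<N. h j y) = (\<Sum>k<N. (\<Sum>j<N. (\<zeta> ^ k) ^ j) * f (y + m k))"
      unfolding h_def by (subst sum.swap) (simp add: sum_distrib_right)
    also have "\<dots> = (\<Sum>k<N. if k = 0 then of_nat N * f y else 0)"
      by (intro sum.cong refl) (auto simp: orth m_def)
    finally show ?thesis using N by simp
  qed
  obtain j where j: "h j x \<noteq> h j 0"
    using sum_h[of x] sum_h[of 0] neq N by (metis (no_types, lifting) mult_cancel_left
        of_nat_eq_0_iff neq0_conv sum.cong)
  have "h j (y + g) = inverse (\<zeta> ^ j) * h j y" for y
  proof -
    define F where "F k = (\<zeta> ^ k) ^ j * f (y + m k)" for k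
    \<comment> \<open>The summand is periodic, since \<open>\<zeta> ^ N = 1\<close> and
      \<open>N\<close> copies of \<open>g\<close> add up to \<open>0\<close>; hence shifting
      \<open>k\<close> by one preserves the sum.\<close>
    have "F N = F 0"
      using \<zeta>_N by (simp add: F_def m_def N_def sum_const_card_UNIV_eq_0 del: sum_constant)
    then have "(\<Sum>k<N. F (Suc k)) = (\<Sum>k<N. F k)"
      using sum.lessThan_Suc_shift[of F N] by simp
    moreover have "F (Suc k) = \<zeta> ^ j * ((\<zeta> ^ k) ^ j * f (y + g + m k))" for k
      by (simp add: F_def m_def power_mult_distrib add_ac)
    ultimately have "\<zeta> ^ j * h j (y + g) = h j y"
      by (simp add: h_def F_def sum_distrib_left)
    moreover have "\<zeta> \<noteq> 0" by (simp add: \<zeta>_def)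
    ultimately show ?thesis by (simp add: field_simps)
  qed
  moreover have "h j (y + z) = d * h j y" if "\<forall>y. f (y + z) = d * f y" for y z d
  proof -
    have "f (y + z + m k) = d * f (y + m k)" for k
      using that[rule_format, of "y + m k"] by (simp add: add_ac)
    then show ?thesis by (simp add: h_def sum_distrib_left mult_ac)
  qed
  ultimately show ?thesis using j that by blast
qed

text \<open>Induction over the translations, starting from the indicator of \<open>0\<close>, gives
  a joint eigenvector that separates \<open>x\<close> from \<open>0\<close>. Its eigenvalue, as a
  function of the translation, is the character.\<close>

lemma ex_character_neq_1:
  fixes x :: "'a::{ab_group_add, finite}"
  assumes "x \<noteq> 0"
  obtains \<chi> where "\<chi> \<in> characters" "\<chi> x \<noteq> 1"
proof -
  have "\<exists>f :: 'a \<Rightarrow> complex. f x \<noteq> f 0 \<and> (\<forall>g\<in>A. \<exists>c. \<forall>y. f (y + g) = c * f y)"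
    if "finite A" for A :: "'a set"
    using that
  proof induction
    case empty
    show ?case using assms by (intro exI[of _ "\<lambda>y. if y = 0 then 1 else 0"]) auto
  next
    case (insert g A)
    then obtain f :: "'a \<Rightarrow> complex" where f: "f x \<noteq> f 0"
      "\<And>z. z \<in> A \<Longrightarrow> \<exists>c. \<forall>y. f (y + z) = c * f y" by blast
    obtain h c where h: "h x \<noteq> h 0" "\<And>y. h (y + g) = c * h y"
      "\<And>z d. (\<forall>y. f (y + z) = d * f y) \<Longrightarrow> (\<forall>y. h (y + z) = d * h y)"
      using translation_eigenvector[OF f(1), of g] by metis
    show ?case
    proof (intro exI[of _ h] conjI ballI)
      fix z assume "z \<in> insert g A"
      then show "\<exists>c. \<forall>y. h (y + z) = c * h y"
        using h(2,3) f(2) by (metis insertE)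
    qed (rule h(1))
  qed
  from this[of UNIV] obtain f :: "'a \<Rightarrow> complex" and c where
    f: "f x \<noteq> f 0" "\<And>g y. f (y + g) = c g * f y" by (metis UNIV_I finite_UNIV)
  have f_eq: "f y = c y * f 0" for y using f(2)[of 0 y] by simp
  \<comment> \<open>If \<open>f 0\<close> vanished, so would all of \<open>f\<close>, and it could
    not separate \<open>x\<close> from \<open>0\<close>.\<close>
  have f0: "f 0 \<noteq> 0" using f(1) f_eq[of x] by auto
  have c_add: "c (y + z) = c y * c z" for y z
    using f(2)[of y z] f_eq[of y] f_eq[of "y + z"] f0 by simp
  have "c 0 = 1" using f_eq[of 0] f0 by simp
  then have "c y * c (- y) = 1" for y using c_add[of y "- y"] by simp
  then have "c y \<noteq> 0" for y by (metis mult_zero_left zero_neq_one)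
  then have "c \<in> characters" by (simp add: characters_def c_add)
  moreover have "c x \<noteq> 1" using f(1) f_eq[of x] by auto
  ultimately show ?thesis by (rule that)
qed

lemma character_0:
  assumes "\<chi> \<in> characters"
  shows "\<chi> 0 = 1"
proof -
  have "\<chi> (0 + 0) = \<chi> 0 * \<chi> 0" "\<chi> 0 \<noteq> 0"
    using assms unfolding characters_def by blast+
  then show ?thesis by simp
qed

text \<open>Translating the product of all values of \<open>\<chi>\<close> by \<open>x\<close> shows
  that \<open>\<chi> x\<close> is an \<open>N\<close>-th root of unity for the group order
  \<open>N\<close>. So the characters lie in a finite function space.\<close>

lemma finite_characters: "finite (characters :: ('a::{ab_group_add, finite} \<Rightarrow> complex) set)"
proof -
  define N where "N = card (UNIV :: 'a set)"
  have "\<chi> x ^ N = 1" if "\<chi> \<in> characters" for \<chi> and x :: 'a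
  proof -
    have "(\<Prod>y\<in>UNIV. \<chi> y) = (\<Prod>y\<in>UNIV. \<chi> (x + y))"
      by (rule prod.reindex_bij_witness[of _ "\<lambda>y. x + y" "\<lambda>y. y - x"]) auto
    also have "\<dots> = \<chi> x ^ N * (\<Prod>y\<in>UNIV. \<chi> y)"
      using that by (simp add: characters_def N_def prod.distrib)
    finally show ?thesis using that by (simp add: characters_def)
  qed
  moreover have "finite {z :: complex. z ^ N = 1}"
    by (rule finite_roots_unity) (simp add: N_def Suc_leI finite_UNIV_card_ge_0)
  then have "finite (Pi\<^sub>E (UNIV :: 'a set) (\<lambda>_. {z :: complex. z ^ N = 1}))"
    by (intro finite_PiE) auto
  ultimately show ?thesis
    by (elim finite_subset[rotated]) auto
qed

text \<open>If \<open>\<chi> y \<noteq> 1\<close>, translation by \<open>y\<close> preserves the sum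
  and also scales it by \<open>\<chi> y\<close>, which forces it to be zero.\<close>

lemma sum_character:
  fixes \<chi> :: "'a::{ab_group_add, finite} \<Rightarrow> complex"
  assumes "\<chi> \<in> characters"
  shows "(\<Sum>x\<in>UNIV. \<chi> x) = (if \<chi> = (\<lambda>_. 1) then of_nat (card (UNIV :: 'a set)) else 0)"
proof (cases "\<chi> = (\<lambda>_. 1)")
  case False
  then obtain y where y: "\<chi> y \<noteq> 1" by auto
  have "(\<Sum>x\<in>UNIV. \<chi> x) = (\<Sum>x\<in>UNIV. \<chi> (y + x))"
    by (rule sum.reindex_bij_witness[of _ "\<lambda>x. y + x" "\<lambda>x. x - y"]) auto
  also have "\<dots> = \<chi> y * (\<Sum>x\<in>UNIV. \<chi> x)"
    using assms by (simp add: characters_def sum_distrib_left)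
  finally show ?thesis using y False by simp
qed simp

lemma sum_over_characters:
  fixes x :: "'a::{ab_group_add, finite}"
  shows "(\<Sum>\<chi>\<in>characters. \<chi> x) = (if x = 0 then of_nat (card (UNIV :: 'a set)) else 0)"
proof -
  let ?s = "\<lambda>x :: 'a. \<Sum>\<chi>\<in>characters. \<chi> x"
  have zero: "?s x = 0" if x: "x \<noteq> 0" for x
  proof -
    obtain \<psi> where \<psi>: "\<psi> \<in> characters" "\<psi> x \<noteq> 1"
      using ex_character_neq_1[OF x] by blast
    \<comment> \<open>Pointwise multiplication by \<open>\<psi>\<close> permutes the characters,
      with pointwise division as its inverse.\<close>
    have "?s x = (\<Sum>\<chi>\<in>characters. \<psi> x * \<chi> x)"
      using \<psi>(1)
      by (intro sum.reindex_bij_witness[of _ "\<lambda>\<chi> y. \<psi> y * \<chi> y" "\<lambda>\<chi> y. \<chi> y / \<psi> y"])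
        (auto simp: characters_def field_simps)
    then show ?thesis using \<psi>(2) by (simp flip: sum_distrib_left)
  qed
  \<comment> \<open>\<open>?s 0\<close> is the number of characters. The double sum over
    \<open>x\<close> and \<open>\<chi>\<close> determines it: one order leaves only
    \<open>x = 0\<close>, the other only the trivial character.\<close>
  have "?s 0 = (\<Sum>x\<in>(UNIV :: 'a set). if x = 0 then ?s 0 else 0)" by simp
  also have "\<dots> = (\<Sum>x\<in>UNIV. ?s x)" by (intro sum.cong) (auto simp: zero)
  also have "\<dots> = (\<Sum>\<chi>\<in>characters. \<Sum>x\<in>(UNIV :: 'a set). \<chi> x)" by (rule sum.swap)
  also have "\<dots> = (\<Sum>\<chi>\<in>characters.
      if \<chi> = (\<lambda>_ :: 'a. 1) then of_nat (card (UNIV :: 'a set)) else 0)"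
    by (intro sum.cong) (auto simp: sum_character)
  also have "\<dots> = of_nat (card (UNIV :: 'a set))"
    by (simp add: finite_characters) (simp add: characters_def)
  finally show ?thesis using zero by simp
qed

section \<open>Invariant sequences supported on a union of orbits\<close>

text \<open>The zero-sum condition is left to the characters; the bound \<open>U\<close> on the
  support allows orbits to be added one at a time.\<close>

definition invariant_seqs :: "('a \<Rightarrow> 'a) \<Rightarrow> 'a set \<Rightarrow> nat \<Rightarrow> 'a multiset set" where
  "invariant_seqs a U m = {S. size S = m \<and> image_mset a S = S \<and> set_mset S \<subseteq> U}"

lemma finite_invariant_seqs [simp]:
  fixes a :: "'a::finite \<Rightarrow> 'a"
  shows "finite (invariant_seqs a U m)"
  by (rule finite_subset[OF _ finite_multisets_of_size[of UNIV m]])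
    (auto simp: invariant_seqs_def multisets_of_size_def)

lemma invariant_seqs_mono: "U \<subseteq> V \<Longrightarrow> invariant_seqs a U m \<subseteq> invariant_seqs a V m"
  by (auto simp: invariant_seqs_def)

lemma orbit_subset_set_mset:
  assumes "image_mset a S = S" "x \<in># S"
  shows "orbit a x \<subseteq> set_mset S"
proof
  fix y assume "y \<in> orbit a x"
  then show "y \<in># S"
    by induction (use assms in \<open>metis imageI set_image_mset\<close>)+
qed

lemma cyclic_on_image_eq:
  assumes "cyclic_on a B"
  shows "a ` B = B"
proof -
  obtain x where x: "x \<in> B" "B = orbit a x" using assms unfolding cyclic_on_def by blast
  have "a ` orbit a x = orbit a (a x)"
    using x by (intro orbit_inverse) auto
  then show ?thesis using x assms by (metis cyclic_on_inI orbit_cyclic_eq3)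
qed

lemma image_mset_mset_set_cyclic:
  assumes "inj a" "cyclic_on a B"
  shows "image_mset a (mset_set B) = mset_set B"
  using image_mset_mset_set[of a B] cyclic_on_image_eq[OF assms(2)] assms(1)
  by (simp add: inj_on_subset)

text \<open>An invariant support that meets the cycle \<open>B\<close> contains all of it, so one
  copy of \<open>B\<close> can be split off. The rest may still meet \<open>B\<close>, hence
  \<open>B \<union> U\<close> recurs on the right.\<close>

lemma invariant_seqs_insert:
  fixes a :: "'a::finite \<Rightarrow> 'a"
  assumes a: "inj a" and B: "cyclic_on a B"
  shows "invariant_seqs a (B \<union> U) m =
    invariant_seqs a (U - B) m \<union>
    (if card B \<le> m then (\<lambda>S. mset_set B + S) ` invariant_seqs a (B \<union> U) (m - card B) else {})"
    (is "?L = ?R")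
proof (intro equalityI subsetI)
  fix S assume S: "S \<in> ?L"
  show "S \<in> ?R"
  proof (cases "set_mset S \<inter> B = {}")
    case True
    then show ?thesis using S by (auto simp: invariant_seqs_def)
  next
    case False
    then have "B \<subseteq> set_mset S"
      using S B orbit_subset_set_mset[of a S] orbit_cyclic_eq3[OF B]
      by (fastforce simp: invariant_seqs_def)
    then have le: "mset_set B \<subseteq># S"
      by (meson finite mset_set_set_mset_msubset msubset_mset_set_iff subset_mset.order_trans
          finite_set_mset)
    have "card B \<le> m" using size_mset_mono[OF le] S by (simp add: invariant_seqs_def)
    moreover have "S - mset_set B \<in> invariant_seqs a (B \<union> U) (m - card B)"
      using S le image_mset_mset_set_cyclic[OF a B]
      by (auto simp: invariant_seqs_def size_Diff_submset image_mset_Diff dest: in_diffD)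
    moreover have "S = mset_set B + (S - mset_set B)" using le by simp
    ultimately show ?thesis by auto
  qed
next
  fix S assume "S \<in> ?R"
  then show "S \<in> ?L"
    using image_mset_mset_set_cyclic[OF a B]
    by (auto simp: invariant_seqs_def split: if_splits)
qed

text \<open>The coefficient ring is left general so that one recurrence serves both the polynomial
  ring, with \<open>q\<close> an indeterminate, and the complex numbers, with
  \<open>q = 1\<close>.\<close>

definition weighted_series ::
    "'r \<Rightarrow> ('a::comm_monoid_add \<Rightarrow> 'r) \<Rightarrow> ('a \<Rightarrow> 'a) \<Rightarrow> 'a set \<Rightarrow> 'r::comm_ring_1 fps" where
  "weighted_series q \<psi> a U =
    Abs_fps (\<lambda>m. \<Sum>S\<in>invariant_seqs a U m. q ^ card (set_mset S) * \<psi> (sum_mset S))"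

text \<open>This is the recurrence \<open>rec\<close> for the coefficients, obtained by splitting
  off one copy of \<open>B\<close>, rewritten for power series.\<close>

lemma weighted_series_insert:
  fixes a :: "'a::{comm_monoid_add, finite} \<Rightarrow> 'a" and q :: "'r::comm_ring_1"
  assumes a: "inj a" and B: "cyclic_on a B" and disj: "B \<inter> U = {}"
    and \<psi>: "\<And>x y. \<psi> (x + y) = \<psi> x * \<psi> y"
  shows "weighted_series q \<psi> a (B \<union> U) * (1 - fps_const (\<psi> (\<Sum>B)) * fps_X ^ card B) =
    weighted_series q \<psi> a U * (1 + fps_const ((q ^ card B - 1) * \<psi> (\<Sum>B)) * fps_X ^ card B)"
proof (rule fps_ext)
  fix m
  define l where "l = card B"
  define w where "w S = q ^ card (set_mset S) * \<psi> (sum_mset S)" for S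
  define W where "W V k = (\<Sum>S\<in>invariant_seqs a V k. w S)" for V k
  have "B \<noteq> {}" using B by (auto simp: cyclic_on_def)
  have nth: "fps_nth (weighted_series q \<psi> a V) k = W V k" for V k
    by (simp add: weighted_series_def W_def w_def)
  have rec: "W (B \<union> U) m = W U m +
      (if l \<le> m then \<psi> (\<Sum>B) * (W (B \<union> U) (m - l) + (q ^ l - 1) * W U (m - l)) else 0)"
  proof (cases "l \<le> m")
    case False
    then show ?thesis
      using disj by (simp add: W_def invariant_seqs_insert[OF a B, of U m] l_def Diff_triv Int_commute)
  next
    case True
    let ?I = "invariant_seqs a (B \<union> U) (m - l)" and ?J = "invariant_seqs a U (m - l)"
    have UB: "U - B = U" using disj by blast
    \<comment> \<open>Adding \<open>B\<close> enlarges the support, by \<open>l\<close> elements,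
      only if \<open>S\<close> avoids \<open>B\<close>, that is, if \<open>S\<close> lies in
      \<open>?J\<close>; the correction then turns the factor \<open>1\<close> into
      \<open>q ^ l\<close>.\<close>
    have w_add: "w (mset_set B + S) = \<psi> (\<Sum>B) * (w S + (if S \<in> ?J then (q ^ l - 1) * w S else 0))"
      if S: "S \<in> ?I" for S
    proof (cases "S \<in> ?J")
      case True
      then have "B \<inter> set_mset S = {}" using disj by (auto simp: invariant_seqs_def)
      then have "card (B \<union> set_mset S) = l + card (set_mset S)"
        by (simp add: card_Un_disjoint l_def)
      then show ?thesis
        using True by (simp add: w_def \<psi> sum_unfold_sum_mset power_add) (simp add: algebra_simps)
    next
      case False
      then obtain x where "x \<in> B" "x \<in># S" using S by (auto simp: invariant_seqs_def)
      then have "B \<subseteq> set_mset S"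
        using S orbit_subset_set_mset[of a S x] orbit_cyclic_eq3[OF B]
        by (auto simp: invariant_seqs_def)
      then have "B \<union> set_mset S = set_mset S" by blast
      then show ?thesis
        using False by (simp add: w_def \<psi> sum_unfold_sum_mset mult_ac)
    qed
    \<comment> \<open>Every sequence in the image contains the nonempty set \<open>B\<close>, which
      is disjoint from \<open>U\<close>.\<close>
    have "invariant_seqs a U m \<inter> (\<lambda>S. mset_set B + S) ` ?I = {}"
      using \<open>B \<noteq> {}\<close> disj by (fastforce simp: invariant_seqs_def)
    moreover have "invariant_seqs a (B \<union> U) m = invariant_seqs a U m \<union> (\<lambda>S. mset_set B + S) ` ?I"
      using invariant_seqs_insert[OF a B, of U m] True unfolding UB l_def by simp
    ultimately have "W (B \<union> U) m = W U m + (\<Sum>S\<in>(\<lambda>S. mset_set B + S) ` ?I. w S)"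
      by (simp add: W_def sum.union_disjoint)
    also have "(\<Sum>S\<in>(\<lambda>S. mset_set B + S) ` ?I. w S) = (\<Sum>S\<in>?I. w (mset_set B + S))"
      by (subst sum.reindex) (auto simp: inj_on_def)
    also have "\<dots> = \<psi> (\<Sum>B) * (W (B \<union> U) (m - l) +
        (\<Sum>S\<in>?I. if S \<in> ?J then (q ^ l - 1) * w S else 0))"
      by (simp add: w_add W_def sum_distrib_left[symmetric] sum.distrib)
    also have "(\<Sum>S\<in>?I. if S \<in> ?J then (q ^ l - 1) * w S else 0) = (q ^ l - 1) * W U (m - l)"
      using invariant_seqs_mono[of U "B \<union> U" a "m - l"]
      by (simp add: sum.inter_restrict[symmetric] Int_absorb1 W_def sum_distrib_left)
    finally show ?thesis using True by simp
  qed
  have shift: "fps_nth (F * (fps_const c * fps_X ^ l)) m =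
      (if l \<le> m then c * fps_nth F (m - l) else 0)" for F :: "'r fps" and c
    by (simp add: mult.left_commute[of F] fps_X_power_mult_right_nth)
  show "fps_nth (weighted_series q \<psi> a (B \<union> U) * (1 - fps_const (\<psi> (\<Sum>B)) * fps_X ^ card B)) m =
    fps_nth (weighted_series q \<psi> a U *
      (1 + fps_const ((q ^ card B - 1) * \<psi> (\<Sum>B)) * fps_X ^ card B)) m"
    using rec unfolding l_def[symmetric] ring_distribs mult_1_right fps_add_nth fps_sub_nth shift nth
    by (simp add: algebra_simps)
qed

text \<open>Induction over the set of cycles. It starts from the empty sequence alone, whose weight
  is \<open>\<psi> 0 = 1\<close>.\<close>

lemma weighted_series_mult_prod:
  fixes a :: "'a::{comm_monoid_add, finite} \<Rightarrow> 'a" and q :: "'r::comm_ring_1"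
  assumes a: "inj a" and \<psi>: "\<And>x y. \<psi> (x + y) = \<psi> x * \<psi> y" "\<psi> 0 = 1"
    and "finite \<Omega>" "\<And>B. B \<in> \<Omega> \<Longrightarrow> cyclic_on a B"
  shows "weighted_series q \<psi> a (\<Union>\<Omega>) * (\<Prod>B\<in>\<Omega>. 1 - fps_const (\<psi> (\<Sum>B)) * fps_X ^ card B) =
    (\<Prod>B\<in>\<Omega>. 1 + fps_const ((q ^ card B - 1) * \<psi> (\<Sum>B)) * fps_X ^ card B)"
  using assms(4,5)
proof induction
  case empty
  have "invariant_seqs a {} m = (if m = 0 then {{#}} else {})" for m
    by (auto simp: invariant_seqs_def)
  then show ?case by (intro fps_ext) (simp add: weighted_series_def \<psi>(2))
next
  case (insert B \<Omega>)
  \<comment> \<open>A cycle is the orbit of each of its elements, so distinct cycles cannot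
    meet.\<close>
  have "B \<inter> C = {}" if "C \<in> \<Omega>" for C
  proof -
    have "C \<noteq> B" using that insert.hyps by auto
    then show ?thesis
      using insert.prems[of B] insert.prems[of C] that by (auto dest: orbit_cyclic_eq3)
  qed
  then have "B \<inter> \<Union>\<Omega> = {}" by blast
  from weighted_series_insert[OF a _ this \<psi>(1), of q] insert show ?case
    by (simp add: ac_simps) (metis (no_types, lifting) mult.assoc mult.commute)
qed

section \<open>The generating functions\<close>

lemma orbits_cyclic_on:
  fixes a :: "'a::finite \<Rightarrow> 'a"
  assumes "bij a" "B \<in> orbits a"
  shows "cyclic_on a B"
  using assms by (auto simp: orbits_def permutation intro: cyclic_on_orbit')

lemma Union_orbits:
  fixes a :: "'a::finite \<Rightarrow> 'a"
  assumes "bij a"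
  shows "\<Union>(orbits a) = UNIV"
  using permutation_self_in_orbit[of a] assms by (auto simp: orbits_def permutation)

lemma fixed_zero_sum_seqs_altdef:
  "fixed_zero_sum_seqs a m = {S \<in> invariant_seqs a UNIV m. sum_mset S = 0}"
  by (auto simp: fixed_zero_sum_seqs_def zero_sum_seqs_def invariant_seqs_def)

text \<open>Orthogonality applied coefficientwise. The additive map \<open>\<iota>\<close> stands
  for the embedding of constants into the polynomials or for the identity.\<close>

lemma sum_weighted_series_characters:
  fixes a :: "'a::{ab_group_add, finite} \<Rightarrow> 'a" and q :: "'r::comm_ring_1"
    and \<iota> :: "complex \<Rightarrow> 'r"
  assumes \<iota>: "\<iota> 0 = 0" "\<And>x y. \<iota> (x + y) = \<iota> x + \<iota> y"
  shows "(\<Sum>\<chi>\<in>characters. weighted_series q (\<lambda>x. \<iota> (\<chi> x)) a UNIV) =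
    fps_const (\<iota> (of_nat (card (UNIV :: 'a set)))) *
    Abs_fps (\<lambda>m. \<Sum>S\<in>fixed_zero_sum_seqs a m. q ^ card (set_mset S))"
proof (rule fps_ext)
  fix m
  let ?N = "of_nat (card (UNIV :: 'a set))"
  have \<iota>_sum: "(\<Sum>\<chi>\<in>A. \<iota> (\<chi> x)) = \<iota> (\<Sum>\<chi>\<in>A. \<chi> x)" for A and x :: 'a
    by (induction A rule: infinite_finite_induct) (simp_all add: \<iota>)
  have "fps_nth (\<Sum>\<chi>\<in>characters. weighted_series q (\<lambda>x. \<iota> (\<chi> x)) a UNIV) m =
    (\<Sum>S\<in>invariant_seqs a UNIV m. q ^ card (set_mset S) * (\<Sum>\<chi>\<in>characters. \<iota> (\<chi> (sum_mset S))))"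
    by (simp add: fps_sum_nth weighted_series_def sum.swap[of _ "invariant_seqs a UNIV m"]
        sum_distrib_left)
  also have "\<dots> = (\<Sum>S\<in>invariant_seqs a UNIV m.
      if sum_mset S = 0 then \<iota> ?N * q ^ card (set_mset S) else 0)"
    by (intro sum.cong refl) (simp add: \<iota>_sum sum_over_characters \<iota>(1))
  also have "\<dots> = \<iota> ?N * (\<Sum>S\<in>fixed_zero_sum_seqs a m. q ^ card (set_mset S))"
    by (auto simp: fixed_zero_sum_seqs_altdef sum_distrib_left sum.inter_filter intro!: sum.cong)
  finally show "fps_nth (\<Sum>\<chi>\<in>characters. weighted_series q (\<lambda>x. \<iota> (\<chi> x)) a UNIV) m =
    fps_nth (fps_const (\<iota> ?N) *
      Abs_fps (\<lambda>m. \<Sum>S\<in>fixed_zero_sum_seqs a m. q ^ card (set_mset S))) m"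
    by simp
qed

lemma fps_nth_one_minus_const_X_power_0:
  fixes c :: "'r::comm_ring_1"
  assumes "l > 0"
  shows "fps_nth (1 - fps_const c * fps_X ^ l) 0 = 1"
  using assms by (simp add: fps_X_power_nth)

theorem proposition2p9:
  fixes a :: "'a::{ab_group_add, finite} \<Rightarrow> 'a"
  assumes "group_automorphism a"
  shows "support_series a =
           fps_const [:1 / of_nat (card (UNIV :: 'a set)):] *
           (\<Sum>\<chi>\<in>characters. \<Prod>B\<in>orbits a.
              fps_quot1
                (1 + fps_const ((monom 1 1 ^ card B - 1) * [:\<chi> (\<Sum>g\<in>B. g):]) * fps_X ^ card B)
                (1 - fps_const [:\<chi> (\<Sum>g\<in>B. g):] * fps_X ^ card B))
       \<and> counting_series a = eval_q 1 (support_series a)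
       \<and> counting_series a =
           fps_const (1 / of_nat (card (UNIV :: 'a set))) *
           (\<Sum>\<chi>\<in>characters. \<Prod>B\<in>orbits a.
              1 / (1 - fps_const (\<chi> (\<Sum>g\<in>B. g)) * fps_X ^ card B))"
proof (intro conjI)
  let ?N = "of_nat (card (UNIV :: 'a set)) :: complex"
  have bij: "bij a" using assms by (simp add: group_automorphism_def)
  then have inj: "inj a" by (rule bij_is_inj)
  have card_pos: "card B > 0" if "B \<in> orbits a" for B
    using orbits_cyclic_on[OF bij that] by (auto simp: cyclic_on_def card_gt_0_iff)
  have N: "?N \<noteq> 0" by simp
  have add: "\<chi> (x + y) = \<chi> x * \<chi> y" if "\<chi> \<in> characters" for \<chi> and x y :: 'a
    using that by (simp add: characters_def)
  have fin: "finite (orbits a)" by simp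
  note prod_eq = weighted_series_mult_prod[OF inj _ _ fin orbits_cyclic_on[OF bij],
      unfolded Union_orbits[OF bij]]
  \<comment> \<open>Both sides agree after multiplication by all denominators, which are then
    cancelled.\<close>
  have quot: "(\<Prod>B\<in>orbits a. fps_quot1
        (1 + fps_const ((monom 1 1 ^ card B - 1) * [:\<chi> (\<Sum>g\<in>B. g):]) * fps_X ^ card B)
        (1 - fps_const [:\<chi> (\<Sum>g\<in>B. g):] * fps_X ^ card B)) =
      weighted_series (monom 1 1) (\<lambda>x. [:\<chi> x:]) a UNIV" (is "prod (\<lambda>B. fps_quot1 (?n B) (?d B)) _ = _")
    if \<chi>: "\<chi> \<in> characters" for \<chi>
  proof -
    have d0: "fps_nth (?d B) 0 = 1" if "B \<in> orbits a" for B
      using card_pos[OF that] by (rule fps_nth_one_minus_const_X_power_0)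
    have "(\<Prod>B\<in>orbits a. fps_quot1 (?n B) (?d B)) * (\<Prod>B\<in>orbits a. ?d B) = (\<Prod>B\<in>orbits a. ?n B)"
      unfolding prod.distrib[symmetric] using d0 by (intro prod.cong refl fps_quot1_mult)
    also have "\<dots> = weighted_series (monom 1 1) (\<lambda>x. [:\<chi> x:]) a UNIV * (\<Prod>B\<in>orbits a. ?d B)"
      by (rule prod_eq[symmetric]) (simp_all add: add[OF \<chi>] character_0[OF \<chi>])
    finally have eq: "(\<Prod>B\<in>orbits a. fps_quot1 (?n B) (?d B)) * (\<Prod>B\<in>orbits a. ?d B) =
        weighted_series (monom 1 1) (\<lambda>x. [:\<chi> x:]) a UNIV * (\<Prod>B\<in>orbits a. ?d B)" .
    \<comment> \<open>Constant term \<open>1\<close> makes each denominator nonzero, and power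
      series over an integral domain allow cancellation.\<close>
    have "?d B \<noteq> 0" if "B \<in> orbits a" for B
      using d0[OF that] by (metis fps_zero_nth zero_neq_one)
    then have "(\<Prod>B\<in>orbits a. ?d B) \<noteq> 0"
      using fin by (simp only: prod_zero_iff) blast
    with eq show ?thesis by (simp only: mult_cancel_right) blast
  qed
  have "(\<Sum>\<chi>\<in>characters. weighted_series (monom 1 1) (\<lambda>x. [:\<chi> x:]) a UNIV) =
      fps_const [:?N:] * support_series a"
    using sum_weighted_series_characters[of "\<lambda>x. [:x:]" "monom 1 1" a]
    by (simp add: support_series_def monom_power)
  then have "fps_const [:1 / ?N:] *
      (\<Sum>\<chi>\<in>characters. weighted_series (monom 1 1) (\<lambda>x. [:\<chi> x:]) a UNIV) = support_series a"
    using N by (simp flip: mult.assoc add: fps_const_mult one_pCons[symmetric])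
  then show "support_series a = fps_const [:1 / ?N:] * (\<Sum>\<chi>\<in>characters. \<Prod>B\<in>orbits a. fps_quot1
        (1 + fps_const ((monom 1 1 ^ card B - 1) * [:\<chi> (\<Sum>g\<in>B. g):]) * fps_X ^ card B)
        (1 - fps_const [:\<chi> (\<Sum>g\<in>B. g):] * fps_X ^ card B))"
    using quot by simp
  show "counting_series a = eval_q 1 (support_series a)"
    by (rule fps_ext) (simp add: counting_series_def eval_q_def support_series_def poly_sum poly_monom)
  \<comment> \<open>The ordinary generating function is obtained directly from the general product
    identity at \<open>q = 1\<close>, without evaluating the two-variable formula.\<close>
  have quot1: "(\<Prod>B\<in>orbits a. 1 / (1 - fps_const (\<chi> (\<Sum>g\<in>B. g)) * fps_X ^ card B)) =
      weighted_series 1 \<chi> a UNIV" (is "prod (\<lambda>B. 1 / ?d B) _ = _")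
    if \<chi>: "\<chi> \<in> characters" for \<chi>
  proof -
    have d0: "fps_nth (?d B) 0 = 1" if "B \<in> orbits a" for B
      using card_pos[OF that] by (rule fps_nth_one_minus_const_X_power_0)
    have "1 / f * f = 1" if "fps_nth f 0 = 1" for f :: "complex fps"
      using that by (simp add: fps_divide_unit inverse_mult_eq_1)
    then have d_unit: "1 / ?d B * ?d B = 1" if "B \<in> orbits a" for B
      using d0[OF that] by blast
    have "(\<Prod>B\<in>orbits a. 1 / ?d B) * (\<Prod>B\<in>orbits a. ?d B) = 1"
      unfolding prod.distrib[symmetric] using d_unit by (intro prod.neutral) blast
    \<comment> \<open>At \<open>q = 1\<close> the factor \<open>q ^ card B - 1\<close> vanishes, so
      every numerator is \<open>1\<close>.\<close>
    also have "\<dots> = weighted_series 1 \<chi> a UNIV * (\<Prod>B\<in>orbits a. ?d B)"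
      by (subst prod_eq) (simp_all add: add[OF \<chi>] character_0[OF \<chi>])
    finally have eq: "(\<Prod>B\<in>orbits a. 1 / ?d B) * (\<Prod>B\<in>orbits a. ?d B) =
        weighted_series 1 \<chi> a UNIV * (\<Prod>B\<in>orbits a. ?d B)" .
    have "?d B \<noteq> 0" if "B \<in> orbits a" for B
      using d0[OF that] by (metis fps_zero_nth zero_neq_one)
    then have "(\<Prod>B\<in>orbits a. ?d B) \<noteq> 0"
      using fin by (simp only: prod_zero_iff) blast
    with eq show ?thesis by (simp only: mult_cancel_right) blast
  qed
  have "(\<Sum>\<chi>\<in>characters. weighted_series 1 \<chi> a UNIV) = fps_const ?N * counting_series a"
    using sum_weighted_series_characters[of "\<lambda>x. x" 1 a] by (simp add: counting_series_def)
  then have "fps_const (1 / ?N) * (\<Sum>\<chi>\<in>characters. weighted_series 1 \<chi> a UNIV) = counting_series a"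
    using N by (simp flip: mult.assoc add: fps_const_mult)
  then show "counting_series a = fps_const (1 / ?N) * (\<Sum>\<chi>\<in>characters. \<Prod>B\<in>orbits a.
      1 / (1 - fps_const (\<chi> (\<Sum>g\<in>B. g)) * fps_X ^ card B))"
    using quot1 by simp
qed

end
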